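(* Let $K$ be any fixed compact subset of $\mathbb{C}^+$. Then, given any $\epsilon>0$, there exist $\delta, N>0$, depending only on $\epsilon$ and $K$, such that the following holds. For every $L\ge N$, every potential function $V$ satisfying $$\int_0^L |V(t)|^2\,dt<\delta,$$ every $z\in K$, and every solution $f(\cdot,z)$ on $[0,\infty)$ of $$-f''(x,z)+V(x)f(x,z)=z f(x,z)$$ satisfying $$\operatorname{Im}\left(-\frac{f'(0,z)}{f(0,z)}\right)>0,$$ one has $$\gamma\left(-\frac{f'(L,z)}{f(L,z)},\, i\sqrt z\right)<\epsilon .$$
   Context: $\mathbb{C}^+=\{z\in\mathbb{C}:\operatorname{Im} z>0\}$. A potential function $V$ is a real-valued function on $[0,\infty)$ that is integrable over every finite subinterval. Solutions of the Schrödinger equation are understood in the usual sense ($f,f'$ locally absolutely continuous, equation holding a.e.); prime denotes $d/dx$. For $z\in\mathbb{C}^+$, $\sqrt z=a+ib$ denotes the square root with $a,b>0$. For $z_1,z_2\in\mathbb{C}^+$, $$\gamma(z_1,z_2)=\frac{|z_1-z_2|}{\sqrt{\operatorname{Im} z_1}\sqrt{\operatorname{Im} z_2}}.$$ *)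

theory Defs
  imports "HOL-Analysis.Analysis"
begin

definition upper_half_plane :: "complex set" where
  "upper_half_plane = {z. 0 < Im z}"

text \<open>Meaningful only for arguments in the upper half-plane; on the real line it is 0 by
  division by zero, so a bound on it should come with membership in the half-plane.\<close>
definition gamma_dist :: "complex \<Rightarrow> complex \<Rightarrow> real" where
  "gamma_dist z1 z2 = cmod (z1 - z2) / (sqrt (Im z1) * sqrt (Im z2))"

text \<open>Only the values on the half-line matter. Integrability is in the sense of Lebesgue.\<close>
definition potential :: "(real \<Rightarrow> real) \<Rightarrow> bool" where
  "potential V \<longleftrightarrow> (\<forall>a b. 0 \<le> a \<and> a \<le> b \<longrightarrow> V absolutely_integrable_on {a..b})"

text \<open>The usual epsilon-delta definition of absolute continuity on an interval. A finite family of
  non-overlapping closed subintervals is a set \<open>D\<close> that is a division of its own union; the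
  interval \<open>k\<close> in \<open>D\<close> has the endpoints \<open>Inf k\<close> and \<open>Sup k\<close>.\<close>
definition abs_continuous_on :: "real \<Rightarrow> real \<Rightarrow> (real \<Rightarrow> 'a::real_normed_vector) \<Rightarrow> bool" where
  "abs_continuous_on a b f \<longleftrightarrow>
    (\<forall>e>0. \<exists>d>0. \<forall>D. D division_of (\<Union>D) \<and> \<Union>D \<subseteq> {a..b} \<and> (\<Sum>k\<in>D. Sup k - Inf k) < d \<longrightarrow>
      (\<Sum>k\<in>D. norm (f (Sup k) - f (Inf k))) < e)"

definition loc_abs_continuous :: "(real \<Rightarrow> 'a::real_normed_vector) \<Rightarrow> bool" where
  "loc_abs_continuous f \<longleftrightarrow> (\<forall>a b. 0 \<le> a \<and> a \<le> b \<longrightarrow> abs_continuous_on a b f)"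

text \<open>The derivative on the half-line, one-sided at 0.\<close>
definition dx :: "(real \<Rightarrow> complex) \<Rightarrow> real \<Rightarrow> complex" where
  "dx f x = vector_derivative f (at x within {0..})"

definition schrodinger_solution :: "(real \<Rightarrow> real) \<Rightarrow> complex \<Rightarrow> (real \<Rightarrow> complex) \<Rightarrow> bool" where
  "schrodinger_solution V z f \<longleftrightarrow>
    f differentiable_on {0..} \<and> loc_abs_continuous f \<and> loc_abs_continuous (dx f) \<and>
    (AE x in lebesgue. 0 \<le> x \<longrightarrow>
      dx f differentiable (at x within {0..}) \<and>
      - dx (dx f) x + complex_of_real (V x) * f x = z * f x)"

end

theory Submission
  imports Defs
begin

text \<open>Put \<open>k = csqrt z\<close> and \<open>m = - f' / f\<close>. Since \<open>(Im (f' cnj f))' = - Im z \<bar>f\<bar>\<^sup>2\<close>, \<open>m\<close> stays in the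
  upper half-plane, so its Cayley transform \<open>r = (m - \<i> k) / (m + \<i> k)\<close> is bounded by
  \<open>R = 1 + 2 \<bar>k\<bar> / Re k\<close>. The Riccati equation for \<open>r\<close> gives
  \<open>(\<bar>r\<bar>\<^sup>2)' \<le> - 4 (Im k) \<bar>r\<bar>\<^sup>2 + R (1 + R)\<^sup>2 \<bar>V\<bar> / \<bar>k\<bar>\<close>. Bounding \<open>\<bar>V\<bar>\<close> by
  \<open>V\<^sup>2 / (2 \<eta>) + \<eta> / 2\<close> and integrating against \<open>exp (4 (Im k) (x - L))\<close> makes \<open>r L\<close> small, uniformly
  for \<open>z\<close> in a compact set.\<close>

section \<open>Absolute continuity and the fundamental theorem of calculus\<close>

text \<open>The intervals of a tagged partial division are non-overlapping, so their total length is
  the measure of their union, which is at most that of \<open>U\<close>. This brings the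
  epsilon-delta definition into the form that a gauge argument can use.\<close>

lemma abs_continuous_onD_tagged:
  fixes F :: "real \<Rightarrow> 'a::real_normed_vector"
  assumes "abs_continuous_on a b F" "e > 0"
  shows "\<exists>d>0. \<forall>q U. q tagged_partial_division_of {a..b} \<longrightarrow> U \<in> lmeasurable \<longrightarrow>
    measure lebesgue U < d \<longrightarrow> (\<forall>(x,K)\<in>q. K \<subseteq> U) \<longrightarrow>
    (\<Sum>(x,K)\<in>q. norm (F (Sup K) - F (Inf K))) < e"
proof -
  obtain d where "d > 0" and d: "\<And>D. \<lbrakk>D division_of (\<Union>D); \<Union>D \<subseteq> {a..b}; (\<Sum>k\<in>D. Sup k - Inf k) < d\<rbrakk> \<Longrightarrow>
      (\<Sum>k\<in>D. norm (F (Sup k) - F (Inf k))) < e"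
    using assms(1)[unfolded abs_continuous_on_def, THEN spec, THEN mp, OF assms(2)] by blast
  show ?thesis
  proof (intro exI[of _ d] conjI allI impI \<open>d > 0\<close>)
    fix q U
    assume q: "q tagged_partial_division_of {a..b}" and U: "U \<in> lmeasurable" "measure lebesgue U < d"
      and sub: "\<forall>(x, K)\<in>q. K \<subseteq> U"
    define D where "D = snd ` q"
    have D: "D division_of (\<Union>D)"
      unfolding D_def using q by (rule partial_division_of_tagged_division)
    have "\<Union>D \<subseteq> {a..b}"
      unfolding D_def using tagged_partial_division_ofD(3)[OF q] by fastforce
    moreover have "(\<Sum>k\<in>D. Sup k - Inf k) < d"
    proof -
      have "(\<Sum>k\<in>D. Sup k - Inf k) = (\<Sum>k\<in>D. measure lebesgue k)"
      proof (rule sum.cong)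
        fix k assume "k \<in> D"
        then obtain u v where "k = cbox u v" "k \<noteq> {}" using division_ofD(3,4)[OF D] by blast
        then show "Sup k - Inf k = measure lebesgue k" by auto
      qed simp
      also have "\<dots> = measure lebesgue (\<Union>D)"
        using content_division[OF D] by simp
      also have "\<dots> \<le> measure lebesgue U"
      proof (rule measure_mono_fmeasurable)
        show "\<Union>D \<subseteq> U" using sub by (force simp: D_def)
        show "\<Union>D \<in> sets lebesgue" by (rule fmeasurableD[OF lmeasurable_division[OF D]])
        show "U \<in> lmeasurable" by fact
      qed
      finally show ?thesis using U by simp
    qed
    ultimately have "(\<Sum>k\<in>D. norm (F (Sup k) - F (Inf k))) < e"
      using D d by blast
    moreover have "(\<Sum>(x,K)\<in>q. norm (F (Sup K) - F (Inf K))) = (\<Sum>k\<in>D. norm (F (Sup k) - F (Inf k)))"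
    proof -
      \<comment> \<open>The sum over \<open>q\<close> and the sum over \<open>D\<close> agree only
        if degenerate intervals contribute 0. \<open>Sup\<close> and \<open>Inf\<close> carry no
        information at the empty set, so its value is set to 0 by hand.\<close>
      define h where "h = (\<lambda>K. if K = {} then 0 else norm (F (Sup K) - F (Inf K)))"
      have "(\<Sum>(x,K)\<in>q. norm (F (Sup K) - F (Inf K))) = (\<Sum>(x,K)\<in>q. h K)"
        using tagged_partial_division_ofD(2)[OF q] by (intro sum.cong) (fastforce simp: h_def)+
      also have "\<dots> = (\<Sum>k\<in>D. h k)"
        unfolding D_def
      proof (rule sum.over_tagged_division_lemma[OF tagged_partial_division_of_Union_self[OF q]])
        fix u v :: real assume "box u v = {}"
        then have "v \<le> u" by simp
        then show "h (cbox u v) = 0"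
          by (cases "v = u") (auto simp: h_def)
      qed
      also have "\<dots> = (\<Sum>k\<in>D. norm (F (Sup k) - F (Inf k)))"
        using division_ofD(3)[OF D] by (intro sum.cong) (auto simp: h_def)
      finally show ?thesis .
    qed
    ultimately show "(\<Sum>(x,K)\<in>q. norm (F (Sup K) - F (Inf K))) < e" by simp
  qed
qed

text \<open>Riemann sums of a fine tagged division are split by tags: the derivative controls the tags outside
  \<open>E\<close>, and those in \<open>E\<close> have intervals inside an open set of small measure.\<close>
theorem fundamental_theorem_of_calculus_abs_continuous:
  fixes F :: "real \<Rightarrow> 'a::banach"
  assumes "a \<le> b" and ac: "abs_continuous_on a b F" and E: "negligible E"
    and der: "\<And>x. x \<in> {a..b} - E \<Longrightarrow> (F has_vector_derivative F' x) (at x within {a..b})"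
  shows "(F' has_integral (F b - F a)) {a..b}"
proof (cases "a = b")
  case True
  then show ?thesis using has_integral_refl(2)[of F' b] by simp
next
  case False
  with \<open>a \<le> b\<close> have "a < b" by simp
  \<comment> \<open>With the integrand set to 0 on \<open>E\<close>, tags in \<open>E\<close>
    contribute only increments of \<open>F\<close> to the error. The change is undone at the end,
    \<open>E\<close> being negligible.\<close>
  define G where "G = (\<lambda>x. if x \<in> E then 0 else F' x)"
  have "(G has_integral (F b - F a)) {a..b}"
    unfolding has_integral_factor_content box_real[symmetric]
  proof safe
    fix e :: real
    assume "e > 0"
    then have "e/2 > 0" by simp
    then have "\<forall>x. \<exists>d>0. x \<in> {a..b} - E \<longrightarrow>
           (\<forall>y\<in>{a..b}. norm (y-x) < d \<longrightarrow> norm (F y - F x - (y-x) *\<^sub>R F' x) \<le> e/2 * norm (y-x))"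
      using der[unfolded has_vector_derivative_def has_derivative_within_alt] by blast
    then obtain d where d: "\<And>x. 0 < d x"
           "\<And>x y. \<lbrakk>x \<in> {a..b} - E; y \<in> {a..b}; norm (y-x) < d x\<rbrakk>
                        \<Longrightarrow> norm (F y - F x - (y-x) *\<^sub>R F' x) \<le> e/2 * norm (y-x)"
      by metis
    have "e/2 * (b - a) > 0" using \<open>e > 0\<close> \<open>a < b\<close> by simp
    then obtain \<delta> where "\<delta> > 0" and \<delta>:
      "\<And>q U. \<lbrakk>q tagged_partial_division_of {a..b}; U \<in> lmeasurable; measure lebesgue U < \<delta>;
         \<forall>(x,K)\<in>q. K \<subseteq> U\<rbrakk> \<Longrightarrow> (\<Sum>(x,K)\<in>q. norm (F (Sup K) - F (Inf K))) < e/2 * (b - a)"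
      using abs_continuous_onD_tagged[OF ac] by blast
    have "E \<in> sets lebesgue" "measure lebesgue E = 0"
      using negligible_imp_measurable[OF E] negligible_imp_measure0[OF E] by (simp_all add: fmeasurableD)
    with \<open>\<delta> > 0\<close> obtain U where U: "open U" "E \<subseteq> U" "U - E \<in> lmeasurable" "emeasure lebesgue (U - E) < \<delta>"
      using sets_lebesgue_outer_open by blast
    have UE: "U = (U - E) \<union> E" using U(2) by blast
    have Um: "U \<in> lmeasurable"
      by (subst UE) (intro fmeasurable.Un U(3) negligible_imp_measurable[OF E])
    have "measure lebesgue U \<le> measure lebesgue (U - E) + measure lebesgue E"
      by (subst UE) (intro measure_Un_le fmeasurableD U(3) negligible_imp_measurable[OF E])
    also have "\<dots> = measure lebesgue (U - E)"
      using E by (simp add: negligible_imp_measure0)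
    also have "\<dots> < \<delta>"
      using U(3,4) \<open>\<delta> > 0\<close> by (simp add: emeasure_eq_measure2 ennreal_less_iff)
    finally have mU: "measure lebesgue U < \<delta>" .
    \<comment> \<open>At a point of \<open>E\<close> the gauge is the whole open set
      \<open>U\<close>, so intervals tagged there stay inside \<open>U\<close>, where absolute
      continuity applies. Elsewhere it is the ball given by differentiability.\<close>
    define \<gamma> where "\<gamma> = (\<lambda>x. if x \<in> E then U else ball x (d x))"
    show "\<exists>d. gauge d \<and> (\<forall>p. p tagged_division_of (cbox a b) \<and> d fine p \<longrightarrow>
      norm ((\<Sum>(x, k)\<in>p. measure lborel k *\<^sub>R G x) - (F b - F a)) \<le> e * measure lborel (cbox a b))"
    proof (rule exI, safe)
      show "gauge \<gamma>"
        unfolding gauge_def \<gamma>_def using U d(1) by auto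
    next
      fix p
      assume ptag: "p tagged_division_of cbox a b" and finep: "\<gamma> fine p"
      have "finite p" using ptag by blast
      define q where "q = {(x,K) \<in> p. x \<in> E}"
      have "q \<subseteq> p" unfolding q_def by auto
      have q: "q tagged_partial_division_of {a..b}"
        using ptag \<open>q \<subseteq> p\<close> by (metis box_real(2) tagged_division_of_def tagged_partial_division_subset)
      have ba: "b - a = (\<Sum>(x,K)\<in>p. Sup K - Inf K)" "F b - F a = (\<Sum>(x,K)\<in>p. F(Sup K) - F(Inf K))"
        using additive_tagged_division_1[where f= "\<lambda>x. x"] additive_tagged_division_1[where f= F]
              \<open>a \<le> b\<close> ptag by auto
      have le: "norm (measure lborel K *\<^sub>R G x - (F (Sup K) - F (Inf K))) \<le> e/2 * (Sup K - Inf K)"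
        if "(x, K) \<in> p - q" for x K
      proof -
        have xE: "x \<notin> E" and "(x,K) \<in> p" using that by (auto simp: q_def)
        then have "x \<in> K" and kab: "K \<subseteq> cbox a b"
          using ptag by blast+
        then obtain u v where k: "K = cbox u v"
          using ptag \<open>(x, K) \<in> p\<close> by auto 
        have "u \<le> v"
          using \<open>x \<in> K\<close> unfolding k by auto
        have ball: "\<forall>y\<in>K. y \<in> ball x (d x)"
          using finep \<open>(x, K) \<in> p\<close> xE by (fastforce simp: \<gamma>_def fine_def)
        have "u \<in> K" "v \<in> K"
          by (simp_all add: \<open>u \<le> v\<close> k)
        \<comment> \<open>The increment over \<open>K\<close> is split at the tag \<open>x\<close>.
          Since \<open>x\<close> lies between \<open>u\<close> and \<open>v\<close>, the two error
          terms add up to \<open>e/2\<close> times the length of \<open>K\<close>.\<close>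
        have "norm ((v - u) *\<^sub>R F' x - (F v - F u)) = norm (F u - F x - (u - x) *\<^sub>R F' x - (F v - F x - (v - x) *\<^sub>R F' x))"
          by (auto simp: algebra_simps)
        also have "\<dots> \<le> norm (F u - F x - (u - x) *\<^sub>R F' x) + norm (F v - F x - (v - x) *\<^sub>R F' x)"
          by (rule norm_triangle_ineq4)
        also have "\<dots> \<le> e/2 * norm (u - x) + e/2 * norm (v - x)"
        proof (rule add_mono)
          show "norm (F u - F x - (u - x) *\<^sub>R F' x) \<le> e/2 * norm (u - x)"
            by (rule d(2)) (use \<open>x \<in> K\<close> \<open>u \<in> K\<close> kab xE ball in \<open>auto simp: dist_real_def\<close>)
          show "norm (F v - F x - (v - x) *\<^sub>R F' x) \<le> e/2 * norm (v - x)"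
            by (rule d(2)) (use \<open>x \<in> K\<close> \<open>v \<in> K\<close> kab xE ball in \<open>auto simp: dist_real_def\<close>)
        qed
        also have "\<dots> = e/2 * (Sup K - Inf K)"
          using \<open>x \<in> K\<close> by (auto simp: k interval_bounds_real[OF \<open>u \<le> v\<close>] field_simps)
        finally show "norm (measure lborel K *\<^sub>R G x - (F (Sup K) - F (Inf K))) \<le> e/2 * (Sup K - Inf K)"
          using \<open>u \<le> v\<close> xE by (simp add: k G_def)
      qed
      have Kle: "Inf K \<le> Sup K" if "(x, K) \<in> q" for x K
      proof -
        have "(x,K) \<in> p" using that by (auto simp: q_def)
        then have "x \<in> K" using ptag by blast+
        then obtain u v where k: "K = cbox u v"
          using ptag \<open>(x, K) \<in> p\<close> by auto 
        then show ?thesis using \<open>x \<in> K\<close> by auto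
      qed
      have "(\<Sum>(x, k)\<in>p. measure lborel k *\<^sub>R G x) - (F b - F a) 
          = (\<Sum>(x, K) \<in> p. (measure lborel K *\<^sub>R G x) - (F (Sup K) - F (Inf K)))"
        by (simp add: ba split_def sum_subtractf)
      also have "norm \<dots> \<le> norm (\<Sum>(x, K) \<in> p - q. (measure lborel K *\<^sub>R G x) - (F (Sup K) - F (Inf K)))
         + norm (\<Sum>(x, K) \<in> q. (measure lborel K *\<^sub>R G x) - (F (Sup K) - F (Inf K)))"
        by (subst sum.subset_diff[OF \<open>q \<subseteq> p\<close> \<open>finite p\<close>]) (rule norm_triangle_ineq)
      also have "\<dots> \<le> e/2 * (b - a) + e/2 * (b - a)"
      proof (rule add_mono)
        have "norm (\<Sum>(x, K) \<in> p - q. (measure lborel K *\<^sub>R G x) - (F (Sup K) - F (Inf K)))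
           \<le> (\<Sum>(x, K) \<in> p - q. e/2 * (Sup K - Inf K))"
          by (rule sum_norm_le) (use le in auto)
        \<comment> \<open>Including the tags in \<open>E\<close> can only increase the sum, by
          \<open>Kle\<close>, and the lengths then add up to \<open>b - a\<close>.\<close>
        also have "\<dots> \<le> (\<Sum>(x, K) \<in> p. e/2 * (Sup K - Inf K))"
          using Kle \<open>q \<subseteq> p\<close> \<open>e > 0\<close> by (intro sum_mono2) (auto simp: \<open>finite p\<close>)
        also have "\<dots> = e/2 * (b - a)"
          by (simp add: ba(1) split_def sum_distrib_left)
        finally show "norm (\<Sum>(x, K) \<in> p - q. (measure lborel K *\<^sub>R G x) - (F (Sup K) - F (Inf K))) \<le> e/2 * (b - a)" .
        have "norm (\<Sum>(x, K) \<in> q. (measure lborel K *\<^sub>R G x) - (F (Sup K) - F (Inf K)))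
           \<le> (\<Sum>(x, K) \<in> q. norm (F (Sup K) - F (Inf K)))"
          by (rule sum_norm_le) (auto simp: q_def G_def norm_minus_commute)
        also have "\<dots> < e/2 * (b - a)"
        proof (rule \<delta>[OF q Um mU], clarify)
          fix x K y assume "(x, K) \<in> q" "y \<in> K"
          then show "y \<in> U"
            using fineD[OF finep, of x K] by (auto simp: q_def \<gamma>_def)
        qed
        finally show "norm (\<Sum>(x, K) \<in> q. (measure lborel K *\<^sub>R G x) - (F (Sup K) - F (Inf K))) \<le> e/2 * (b - a)" by simp
      qed
      also have "\<dots> = e * measure lborel (cbox a b)" using \<open>a < b\<close> by simp
      finally show "norm ((\<Sum>(x, k)\<in>p. measure lborel k *\<^sub>R G x) - (F b - F a)) \<le> e * measure lborel (cbox a b)" .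
    qed
  qed
  then show ?thesis
    by (rule has_integral_spike[OF E, rotated]) (auto simp: G_def)
qed

section \<open>Calculus of absolutely continuous functions\<close>

text \<open>Common source of the closure properties below: each reduces to a pointwise bound on
  increments. When only one function dominates, it is passed as both \<open>f\<close> and
  \<open>g\<close>, and the constant is halved.\<close>

lemma abs_continuous_on_dominated:
  fixes f :: "real \<Rightarrow> 'a::real_normed_vector" and g :: "real \<Rightarrow> 'b::real_normed_vector"
    and h :: "real \<Rightarrow> 'c::real_normed_vector"
  assumes f: "abs_continuous_on a b f" and g: "abs_continuous_on a b g"
    and le: "\<And>x y. \<lbrakk>x \<in> {a..b}; y \<in> {a..b}\<rbrakk> \<Longrightarrow>
      norm (h x - h y) \<le> M * (norm (f x - f y) + norm (g x - g y))"
  shows "abs_continuous_on a b h"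
  unfolding abs_continuous_on_def
proof (intro allI impI)
  fix e :: real assume "e > 0"
  \<comment> \<open>\<open>c\<close> is positive whatever the sign of \<open>M\<close>, and it
    exceeds \<open>\<bar>M\<bar>\<close>, which makes the last estimate strict.\<close>
  define c where "c = \<bar>M\<bar> + 1"
  have "c > 0" unfolding c_def by linarith
  define e' where "e' = e / (2 * c)"
  have "e' > 0" using \<open>e > 0\<close> \<open>c > 0\<close> by (simp add: e'_def)
  obtain d1 where "d1 > 0" and d1: "\<And>D. \<lbrakk>D division_of (\<Union>D); \<Union>D \<subseteq> {a..b}; (\<Sum>k\<in>D. Sup k - Inf k) < d1\<rbrakk> \<Longrightarrow>
      (\<Sum>k\<in>D. norm (f (Sup k) - f (Inf k))) < e'"
    using f[unfolded abs_continuous_on_def, THEN spec, THEN mp, OF \<open>e' > 0\<close>] by blast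
  obtain d2 where "d2 > 0" and d2: "\<And>D. \<lbrakk>D division_of (\<Union>D); \<Union>D \<subseteq> {a..b}; (\<Sum>k\<in>D. Sup k - Inf k) < d2\<rbrakk> \<Longrightarrow>
      (\<Sum>k\<in>D. norm (g (Sup k) - g (Inf k))) < e'"
    using g[unfolded abs_continuous_on_def, THEN spec, THEN mp, OF \<open>e' > 0\<close>] by blast
  show "\<exists>d>0. \<forall>D. D division_of (\<Union>D) \<and> \<Union>D \<subseteq> {a..b} \<and> (\<Sum>k\<in>D. Sup k - Inf k) < d \<longrightarrow>
      (\<Sum>k\<in>D. norm (h (Sup k) - h (Inf k))) < e"
  proof (intro exI[of _ "min d1 d2"] conjI allI impI)
    show "min d1 d2 > 0" using \<open>d1 > 0\<close> \<open>d2 > 0\<close> by simp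
    fix D :: "real set set"
    assume D: "D division_of (\<Union>D) \<and> \<Union>D \<subseteq> {a..b} \<and> (\<Sum>k\<in>D. Sup k - Inf k) < min d1 d2"
    have "norm (h (Sup k) - h (Inf k)) \<le> \<bar>M\<bar> * (norm (f (Sup k) - f (Inf k)) + norm (g (Sup k) - g (Inf k)))"
      if "k \<in> D" for k
    proof -
      obtain u v where k: "k = cbox u v" "k \<noteq> {}"
        using division_ofD(3,4)[OF conjunct1[OF D]] \<open>k \<in> D\<close> by blast
      then have "Sup k \<in> k" "Inf k \<in> k" by auto
      then have "Sup k \<in> {a..b}" "Inf k \<in> {a..b}" using D \<open>k \<in> D\<close> by blast+
      then have "norm (h (Sup k) - h (Inf k)) \<le> M * (norm (f (Sup k) - f (Inf k)) + norm (g (Sup k) - g (Inf k)))"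
        by (rule le)
      also have "\<dots> \<le> \<bar>M\<bar> * (norm (f (Sup k) - f (Inf k)) + norm (g (Sup k) - g (Inf k)))"
        by (intro mult_right_mono) auto
      finally show ?thesis .
    qed
    then have "(\<Sum>k\<in>D. norm (h (Sup k) - h (Inf k)))
      \<le> (\<Sum>k\<in>D. \<bar>M\<bar> * (norm (f (Sup k) - f (Inf k)) + norm (g (Sup k) - g (Inf k))))"
      by (rule sum_mono)
    also have "\<dots> = \<bar>M\<bar> * ((\<Sum>k\<in>D. norm (f (Sup k) - f (Inf k))) + (\<Sum>k\<in>D. norm (g (Sup k) - g (Inf k))))"
      by (simp add: sum_distrib_left sum.distrib distrib_left)
    also have "\<dots> \<le> \<bar>M\<bar> * (e' + e')"
      using d1[of D] d2[of D] D by (intro mult_left_mono add_mono) auto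
    also have "\<dots> < c * (e' + e')"
      using \<open>e' > 0\<close> by (intro mult_strict_right_mono) (auto simp: c_def)
    also have "\<dots> = e" using \<open>c > 0\<close> unfolding e'_def by (simp add: field_simps)
    finally show "(\<Sum>k\<in>D. norm (h (Sup k) - h (Inf k))) < e" .
  qed
qed

text \<open>Increments are dominated by those of the identity, for which \<open>d = e\<close>
  works.\<close>

lemma abs_continuous_on_lipschitz:
  fixes f :: "real \<Rightarrow> 'a::real_normed_vector"
  assumes "\<And>x y. \<lbrakk>x \<in> {a..b}; y \<in> {a..b}\<rbrakk> \<Longrightarrow> norm (f x - f y) \<le> M * \<bar>x - y\<bar>"
  shows "abs_continuous_on a b f"
proof -
  have id: "abs_continuous_on a b (\<lambda>x::real. x)"
    unfolding abs_continuous_on_def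
  proof (intro allI impI)
    fix e :: real assume "e > 0"
    have eq: "(\<Sum>k\<in>D. norm (Sup k - Inf k)) = (\<Sum>k\<in>D. Sup k - Inf k)"
      if D: "D division_of (\<Union>D)" for D :: "real set set"
    proof (rule sum.cong)
      fix k assume "k \<in> D"
      then obtain u v where k: "k = cbox u v" "k \<noteq> {}" using division_ofD(3,4)[OF D] by blast
      then show "norm (Sup k - Inf k) = Sup k - Inf k" by auto
    qed simp
    show "\<exists>d>0. \<forall>D. D division_of (\<Union>D) \<and> \<Union>D \<subseteq> {a..b} \<and> (\<Sum>k\<in>D. Sup k - Inf k) < d \<longrightarrow>
      (\<Sum>k\<in>D. norm (Sup k - Inf k)) < e"
      using \<open>e > 0\<close> by (intro exI[of _ e]) (auto simp: eq simp del: real_norm_def)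
  qed
  show ?thesis
    by (rule abs_continuous_on_dominated[OF id id, where M = "M/2"]) (use assms in auto)
qed

text \<open>A single interval is a division of itself, so the definition applied to it already gives
  continuity.\<close>

lemma abs_continuous_on_imp_continuous_on:
  fixes f :: "real \<Rightarrow> 'a::real_normed_vector"
  assumes "abs_continuous_on a b f"
  shows "continuous_on {a..b} f"
  unfolding continuous_on_iff
proof (intro ballI allI impI)
  fix x e :: real assume x: "x \<in> {a..b}" and "e > 0"
  obtain d where "d > 0" and d: "\<And>D. \<lbrakk>D division_of (\<Union>D); \<Union>D \<subseteq> {a..b}; (\<Sum>k\<in>D. Sup k - Inf k) < d\<rbrakk> \<Longrightarrow>
      (\<Sum>k\<in>D. norm (f (Sup k) - f (Inf k))) < e"
    using assms[unfolded abs_continuous_on_def, THEN spec, THEN mp, OF \<open>e > 0\<close>] by blast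
  have *: "norm (f v - f u) < e" if "u \<le> v" "u \<in> {a..b}" "v \<in> {a..b}" "v - u < d" for u v
    using d[of "{cbox u v}"] that division_of_self[of u v] by auto
  show "\<exists>d>0. \<forall>y\<in>{a..b}. dist y x < d \<longrightarrow> dist (f y) (f x) < e"
  proof (intro exI[of _ d] conjI ballI impI \<open>d > 0\<close>)
    fix y assume "y \<in> {a..b}" "dist y x < d"
    then show "dist (f y) (f x) < e"
      using *[of x y] *[of y x] x by (cases "x \<le> y") (auto simp: dist_norm norm_minus_commute)
  qed
qed

lemma abs_continuous_on_bounded:
  fixes f :: "real \<Rightarrow> 'a::real_normed_vector"
  assumes "abs_continuous_on a b f"
  obtains B where "B > 0" "\<And>x. x \<in> {a..b} \<Longrightarrow> norm (f x) \<le> B"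
proof -
  have "bounded (f ` {a..b})"
    using abs_continuous_on_imp_continuous_on[OF assms]
    by (intro compact_imp_bounded compact_continuous_image) auto
  then show thesis
    using that unfolding bounded_pos by auto
qed

lemma abs_continuous_on_mult:
  fixes f g :: "real \<Rightarrow> 'a::real_normed_algebra"
  assumes f: "abs_continuous_on a b f" and g: "abs_continuous_on a b g"
  shows "abs_continuous_on a b (\<lambda>x. f x * g x)"
proof -
  obtain Bf where Bf: "Bf > 0" "\<And>x. x \<in> {a..b} \<Longrightarrow> norm (f x) \<le> Bf"
    using abs_continuous_on_bounded[OF f] by blast
  obtain Bg where Bg: "Bg > 0" "\<And>x. x \<in> {a..b} \<Longrightarrow> norm (g x) \<le> Bg"
    using abs_continuous_on_bounded[OF g] by blast
  show ?thesis
  proof (rule abs_continuous_on_dominated[OF f g])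
    fix x y assume xy: "x \<in> {a..b}" "y \<in> {a..b}"
    have "f x * g x - f y * g y = (f x - f y) * g x + f y * (g x - g y)"
      by (simp add: algebra_simps)
    also have "norm \<dots> \<le> norm (f x - f y) * norm (g x) + norm (f y) * norm (g x - g y)"
      by (intro order.trans[OF norm_triangle_ineq] add_mono norm_mult_ineq)
    also have "\<dots> \<le> norm (f x - f y) * (Bf + Bg) + (Bf + Bg) * norm (g x - g y)"
      using Bf(1) Bg(1) Bf(2)[OF xy(2)] Bg(2)[OF xy(1)]
      by (intro add_mono mult_left_mono mult_right_mono) auto
    finally show "norm (f x * g x - f y * g y) \<le> (Bf + Bg) * (norm (f x - f y) + norm (g x - g y))"
      by (simp add: algebra_simps)
  qed
qed

text \<open>By compactness \<open>inverse (f x)\<close> is bounded by some \<open>B\<close>, and the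
  difference of two inverses is at most \<open>B\<^sup>2\<close> times the increment of
  \<open>f\<close>.\<close>

lemma abs_continuous_on_inverse:
  fixes f :: "real \<Rightarrow> 'a::real_normed_field"
  assumes f: "abs_continuous_on a b f" and nz: "\<And>x. x \<in> {a..b} \<Longrightarrow> f x \<noteq> 0"
  shows "abs_continuous_on a b (\<lambda>x. inverse (f x))"
proof -
  have "continuous_on {a..b} (\<lambda>x. inverse (f x))"
    using abs_continuous_on_imp_continuous_on[OF f] nz by (intro continuous_on_inverse) auto
  then have "bounded ((\<lambda>x. inverse (f x)) ` {a..b})"
    by (intro compact_imp_bounded compact_continuous_image) auto
  then obtain B where B: "B > 0" "\<And>x. x \<in> {a..b} \<Longrightarrow> norm (inverse (f x)) \<le> B"
    unfolding bounded_pos by auto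
  show ?thesis
  proof (rule abs_continuous_on_dominated[OF f f])
    fix x y assume xy: "x \<in> {a..b}" "y \<in> {a..b}"
    have "norm (inverse (f x) - inverse (f y)) = norm (inverse (f x)) * norm (f x - f y) * norm (inverse (f y))"
      using nz[OF xy(1)] nz[OF xy(2)] by (simp add: inverse_diff_inverse norm_mult)
    also have "\<dots> \<le> B * norm (f x - f y) * B"
      using B(1) B(2)[OF xy(1)] B(2)[OF xy(2)] by (intro mult_mono) auto
    finally show "norm (inverse (f x) - inverse (f y)) \<le> (B\<^sup>2 / 2) * (norm (f x - f y) + norm (f x - f y))"
      by (simp add: algebra_simps power2_eq_square)
  qed
qed

lemma abs_continuous_on_lincomb:
  fixes f g :: "real \<Rightarrow> 'a::real_normed_algebra"
  assumes f: "abs_continuous_on a b f" and g: "abs_continuous_on a b g"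
  shows "abs_continuous_on a b (\<lambda>x. f x + c * g x)"
proof (rule abs_continuous_on_dominated[OF f g])
  fix x y 
  have "norm (f x + c * g x - (f y + c * g y)) = norm ((f x - f y) + c * (g x - g y))"
    by (simp add: algebra_simps)
  also have "\<dots> \<le> norm (f x - f y) + norm c * norm (g x - g y)"
    by (intro order.trans[OF norm_triangle_ineq] add_mono norm_mult_ineq) auto
  also have "\<dots> \<le> (1 + norm c) * (norm (f x - f y) + norm (g x - g y))"
    by (simp add: algebra_simps)
  finally show "norm (f x + c * g x - (f y + c * g y)) \<le> (1 + norm c) * (norm (f x - f y) + norm (g x - g y))" .
qed

lemma has_vector_derivative_quotient:
  fixes f g :: "real \<Rightarrow> 'a::real_normed_field"
  assumes "(f has_vector_derivative f') (at x within S)" "(g has_vector_derivative g') (at x within S)"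
    and "g x \<noteq> 0"
  shows "((\<lambda>x. f x / g x) has_vector_derivative (f' * g x - f x * g') / (g x)\<^sup>2) (at x within S)"
proof -
  have "(\<lambda>h. h *\<^sub>R ((f' * g x - f x * g') / (g x)\<^sup>2)) =
      (\<lambda>h. ((h *\<^sub>R f') * g x - f x * (h *\<^sub>R g')) / (g x * g x))"
    by (simp add: scaleR_conv_of_real power2_eq_square algebra_simps diff_divide_distrib)
  then show ?thesis
    using has_derivative_divide'[OF assms(1,2)[unfolded has_vector_derivative_def] assms(3)]
    unfolding has_vector_derivative_def by simp
qed

section \<open>Solutions and the invariance of the upper half-plane\<close>

text \<open>Collects the exceptional points in one negligible set and solves the equation for the
  second derivative, the form in which the fundamental theorem above can be applied.\<close>

lemma schrodinger_solutionE:
  assumes "schrodinger_solution V z f"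
  obtains E where "negligible E"
    "\<And>x. 0 \<le> x \<Longrightarrow> (f has_vector_derivative dx f x) (at x within {0..})"
    "\<And>x. 0 \<le> x \<Longrightarrow> x \<notin> E \<Longrightarrow>
       (dx f has_vector_derivative (complex_of_real (V x) - z) * f x) (at x within {0..})"
    "\<And>L. 0 \<le> L \<Longrightarrow> abs_continuous_on 0 L f"
    "\<And>L. 0 \<le> L \<Longrightarrow> abs_continuous_on 0 L (dx f)"
proof -
  note sol = assms[unfolded schrodinger_solution_def]
  have "AE x in lebesgue. 0 \<le> x \<longrightarrow>
      dx f differentiable (at x within {0..}) \<and>
      - dx (dx f) x + complex_of_real (V x) * f x = z * f x"
    using sol by blast
  then obtain E where E: "E \<in> null_sets lebesgue" and *: "\<And>x. x \<notin> E \<Longrightarrow> 0 \<le> x \<Longrightarrow>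
      dx f differentiable (at x within {0..}) \<and>
      - dx (dx f) x + complex_of_real (V x) * f x = z * f x"
    by (rule AE_E3) auto
  show thesis
  proof (rule that)
    show "negligible E" using E by (simp add: negligible_iff_null_sets)
    show "(f has_vector_derivative dx f x) (at x within {0..})" if "0 \<le> x" for x
      unfolding dx_def using sol that by (intro vector_derivative_works[THEN iffD1]) (simp add: differentiable_on_def)
    show "(dx f has_vector_derivative (complex_of_real (V x) - z) * f x) (at x within {0..})"
      if "0 \<le> x" "x \<notin> E" for x
    proof -
      have "(dx f has_vector_derivative dx (dx f) x) (at x within {0..})"
        using *[OF that(2,1)] unfolding dx_def[of "dx f"] by (intro vector_derivative_works[THEN iffD1]) blast
      moreover have "dx (dx f) x = (complex_of_real (V x) - z) * f x"
        using *[OF that(2,1)] by (simp add: algebra_simps)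
      ultimately show ?thesis by simp
    qed
    show "abs_continuous_on 0 L f" "abs_continuous_on 0 L (dx f)" if "0 \<le> L" for L
      using sol that unfolding loc_abs_continuous_def by auto
  qed
qed

text \<open>Multiplying through by \<open>cnj w\<close> shows that the sign of
  \<open>Im (- f' / f)\<close> is opposite to that of \<open>Im (f' * cnj f)\<close>, a quantity
  that makes sense even at zeros of \<open>f\<close>.\<close>

lemma Im_minus_divide: "Im (- (u / w)) = - Im (u * cnj w) / (cmod w)\<^sup>2"
  by (subst complex_div_cnj) (simp add: diff_divide_distrib flip: of_real_power)

text \<open>\<open>Im (dx f x * cnj (f x))\<close> is nonincreasing and starts negative. It
  therefore stays negative, which rules out zeros of \<open>f\<close> and keeps
  \<open>- f' / f\<close> in the half-plane.\<close>

lemma schrodinger_solution_half_plane: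
  assumes sol: "schrodinger_solution V z f" and "Im z > 0" and "0 \<le> x"
    and "f 0 \<noteq> 0" "Im (- (dx f 0 / f 0)) > 0"
  shows "f x \<noteq> 0" "Im (- (dx f x / f x)) > 0"
proof -
  obtain E where E: "negligible E"
    and df: "\<And>x. 0 \<le> x \<Longrightarrow> (f has_vector_derivative dx f x) (at x within {0..})"
    and ddf: "\<And>x. 0 \<le> x \<Longrightarrow> x \<notin> E \<Longrightarrow>
       (dx f has_vector_derivative (complex_of_real (V x) - z) * f x) (at x within {0..})"
    and ac: "\<And>L. 0 \<le> L \<Longrightarrow> abs_continuous_on 0 L f"
    "\<And>L. 0 \<le> L \<Longrightarrow> abs_continuous_on 0 L (dx f)"
    using schrodinger_solutionE[OF sol] by blast
  define W where "W = (\<lambda>x. dx f x * cnj (f x))"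
  define W' where "W' = (\<lambda>x. dx f x * cnj (dx f x) + (complex_of_real (V x) - z) * f x * cnj (f x))"
  have "(W' has_integral (W x - W 0)) {0..x}"
  proof (rule fundamental_theorem_of_calculus_abs_continuous[OF \<open>0 \<le> x\<close> _ E])
    have "abs_continuous_on 0 x (\<lambda>x. cnj (f x))"
      by (rule abs_continuous_on_dominated[OF ac(1) ac(1), where M = "1/2"])
        (use \<open>0 \<le> x\<close> in \<open>auto simp flip: complex_cnj_diff\<close>)
    then show "abs_continuous_on 0 x W"
      unfolding W_def using ac(2)[OF \<open>0 \<le> x\<close>] by (rule abs_continuous_on_mult[rotated])
    fix y assume y: "y \<in> {0..x} - E"
    have "(W has_vector_derivative W' y) (at y within {0..})"
      unfolding W_def W'_def
      using y by (intro has_vector_derivative_mult has_vector_derivative_cnj df ddf) auto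
    then show "(W has_vector_derivative W' y) (at y within {0..x})"
      by (rule has_vector_derivative_within_subset) auto
  qed
  from has_integral_linear[OF this bounded_linear_Im]
  have "((\<lambda>y. Im (W' y)) has_integral Im (W x - W 0)) {0..x}"
    by (simp add: o_def)
  moreover have "Im (W' y) \<le> 0" for y
  proof -
    \<comment> \<open>The terms \<open>\<bar>f'\<bar>\<close>-squared and \<open>V\<close> times
      \<open>\<bar>f\<bar>\<close>-squared are real, so only \<open>- z\<close> contributes.\<close>
    have "Im (W' y) = - Im z * (cmod (f y))\<^sup>2"
      unfolding W'_def cmod_power2 by (simp add: algebra_simps power2_eq_square)
    then show ?thesis using \<open>Im z > 0\<close> by simp
  qed
  ultimately have "Im (W x - W 0) \<le> 0"
    by (rule has_integral_le[OF _ has_integral_0])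
  moreover have "Im (W 0) < 0"
    using assms(4,5) unfolding Im_minus_divide W_def by (simp add: zero_less_divide_iff divide_less_0_iff)
  ultimately have Wx: "Im (W x) < 0" by simp
  then show nz: "f x \<noteq> 0" unfolding W_def by auto
  show "Im (- (dx f x / f x)) > 0"
    using Wx nz unfolding Im_minus_divide W_def by (simp add: divide_neg_pos)
qed

section \<open>The Cayley transform and its Riccati estimate\<close>

text \<open>The pole \<open>- \<i> * k\<close> lies at depth \<open>Re k\<close> below the real
  axis, so \<open>m\<close> keeps at least that distance from it. The pole is not the conjugate of
  the zero \<open>\<i> * k\<close> unless \<open>k\<close> is real, hence a bound \<open>R\<close>
  in place of 1. In return, both points are fixed by the free Riccati flow
  \<open>m' = k\<^sup>2 + m\<^sup>2\<close>, which makes the equation for the quotient linear when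
  \<open>V = 0\<close>.\<close>

lemma cayley_bound:
  assumes "Im m > 0" "Re k > 0"
  shows "m + \<i> * k \<noteq> 0" "cmod ((m - \<i> * k) / (m + \<i> * k)) \<le> 1 + 2 * cmod k / Re k"
proof -
  have "Re k \<le> Im (m + \<i> * k)" using assms by simp
  also have "\<dots> \<le> cmod (m + \<i> * k)" using abs_Im_le_cmod[of "m + \<i> * k"] by linarith
  finally have le: "Re k \<le> cmod (m + \<i> * k)" .
  then have pos: "0 < cmod (m + \<i> * k)" using assms by linarith
  then show nz: "m + \<i> * k \<noteq> 0" by auto
  have "(m - \<i> * k) / (m + \<i> * k) = 1 - 2 * \<i> * k / (m + \<i> * k)"
    using nz by (simp add: field_simps)
  also have "cmod \<dots> \<le> 1 + 2 * cmod k / cmod (m + \<i> * k)"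
    by (rule order.trans[OF norm_triangle_ineq4]) (simp add: norm_divide norm_mult)
  also have "\<dots> \<le> 1 + 2 * cmod k / Re k"
    using le assms pos by (intro add_left_mono divide_left_mono mult_pos_pos) auto
  finally show "cmod ((m - \<i> * k) / (m + \<i> * k)) \<le> 1 + 2 * cmod k / Re k" .
qed

text \<open>The quotient \<open>r\<close> below is the Cayley transform of \<open>- f' / f\<close> with zero at \<open>\<i> k\<close>; it solves
  \<open>r' = 2 \<i> k r - V (r - 1)\<^sup>2 / (2 \<i> k)\<close>.\<close>
lemma schrodinger_solution_cayley_estimate:
  assumes sol: "schrodinger_solution V (k\<^sup>2) f" and k: "Re k > 0" "Im k > 0" and "0 \<le> L"
    and init: "f 0 \<noteq> 0" "Im (- (dx f 0 / f 0)) > 0"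
    and V: "((\<lambda>t. (V t)\<^sup>2) has_integral J) {0..L}" and "\<eta> > 0"
  defines "R \<equiv> 1 + 2 * cmod k / Re k" and "m \<equiv> - (dx f L / f L)"
  shows "(cmod ((m - \<i> * k) / (m + \<i> * k)))\<^sup>2 \<le>
    R\<^sup>2 * exp (- 4 * Im k * L) + R * (1 + R)\<^sup>2 / cmod k * (J / (2 * \<eta>) + \<eta> / (8 * Im k))"
proof -
  obtain E where E: "negligible E"
    and df: "\<And>x. 0 \<le> x \<Longrightarrow> (f has_vector_derivative dx f x) (at x within {0..})"
    and ddf: "\<And>x. 0 \<le> x \<Longrightarrow> x \<notin> E \<Longrightarrow>
       (dx f has_vector_derivative (complex_of_real (V x) - k\<^sup>2) * f x) (at x within {0..})"
    and ac: "\<And>L. 0 \<le> L \<Longrightarrow> abs_continuous_on 0 L f"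
    "\<And>L. 0 \<le> L \<Longrightarrow> abs_continuous_on 0 L (dx f)"
    using schrodinger_solutionE[OF sol] by blast
  have "Im (k\<^sup>2) > 0" using k by (simp add: power2_eq_square)
  note hp = schrodinger_solution_half_plane[OF sol this _ init]
  have k0: "k \<noteq> 0" using k by auto
  \<comment> \<open>Up to the common factor \<open>- f\<close>, \<open>A\<close> and
    \<open>B\<close> are the denominator and the numerator of the Cayley transform. They diagonalise
    the free system: for \<open>V = 0\<close> one has \<open>A' = - \<i> k A\<close> and
    \<open>B' = \<i> k B\<close>.\<close>
  define A where "A = (\<lambda>x. dx f x + (- \<i> * k) * f x)"
  define B where "B = (\<lambda>x. dx f x + (\<i> * k) * f x)"
  define r where "r = (\<lambda>x. B x / A x)"
  define s where "s = (\<lambda>x. r x \<bullet> r x)"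
  have A_nz: "A x \<noteq> 0" and r_eq: "r x = (- (dx f x / f x) - \<i> * k) / (- (dx f x / f x) + \<i> * k)"
    if "0 \<le> x" for x
  proof -
    have fx: "f x \<noteq> 0" using hp(1)[OF that] .
    have "A x = - f x * (- (dx f x / f x) + \<i> * k)" "B x = - f x * (- (dx f x / f x) - \<i> * k)"
      using fx by (simp_all add: A_def B_def field_simps)
    then show "A x \<noteq> 0" "r x = (- (dx f x / f x) - \<i> * k) / (- (dx f x / f x) + \<i> * k)"
      using fx cayley_bound(1)[OF hp(2)[OF that] k(1)] by (simp_all add: r_def)
  qed
  have r_le: "cmod (r x) \<le> R" if "0 \<le> x" for x
    unfolding r_eq[OF that] R_def by (rule cayley_bound(2)[OF hp(2)[OF that] k(1)])
  have "R \<ge> 1" using k by (simp add: R_def)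
  define r' where "r' = (\<lambda>x. 2 * \<i> * k * r x - V x * ((r x - 1)\<^sup>2 / (2 * \<i> * k)))"
  have dr: "(r has_vector_derivative r' x) (at x within {0..L})" if "x \<in> {0..L} - E" for x
  proof -
    have "0 \<le> x" "x \<notin> E" using that by auto
    note Anz = A_nz[OF \<open>0 \<le> x\<close>]
    define p where "p = (V x - k\<^sup>2) * f x + (- \<i> * k) * dx f x"
    define q where "q = (V x - k\<^sup>2) * f x + (\<i> * k) * dx f x"
    have "(A has_vector_derivative p) (at x within {0..})"
      unfolding A_def p_def
      by (intro has_vector_derivative_add ddf df has_vector_derivative_mult_right \<open>0 \<le> x\<close> \<open>x \<notin> E\<close>)
    moreover have "(B has_vector_derivative q) (at x within {0..})"
      unfolding B_def q_def
      by (intro has_vector_derivative_add ddf df has_vector_derivative_mult_right \<open>0 \<le> x\<close> \<open>x \<notin> E\<close>)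
    ultimately have "(r has_vector_derivative (q * A x - B x * p) / (A x)\<^sup>2) (at x within {0..})"
      unfolding r_def using Anz by (intro has_vector_derivative_quotient)
    moreover have "(q * A x - B x * p) / (A x)\<^sup>2 = r' x"
    proof -
      have p: "p = V x * f x - \<i> * k * A x" and q: "q = V x * f x + \<i> * k * B x"
        by (simp_all add: p_def q_def A_def B_def algebra_simps power2_eq_square)
      have BA: "B x - A x = 2 * \<i> * k * f x" by (simp add: A_def B_def)
      have "(q * A x - B x * p) / (A x)\<^sup>2 = 2 * \<i> * k * r x - V x * f x * (B x - A x) / (A x)\<^sup>2"
        unfolding p q r_def using Anz by (simp add: field_simps power2_eq_square)
      \<comment> \<open>Expressing \<open>f\<close> by \<open>B - A\<close> turns the potential term
        into a function of \<open>r\<close> alone, quadratic in \<open>r - 1\<close>.\<close>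
      also have "f x = (B x - A x) / (2 * \<i> * k)" using BA k0 by (simp add: field_simps)
      also have "V x * ((B x - A x) / (2 * \<i> * k)) * (B x - A x) / (A x)\<^sup>2
          = V x * ((r x - 1)\<^sup>2 / (2 * \<i> * k))"
      proof -
        have "r x - 1 = (B x - A x) / A x" using Anz by (simp add: r_def field_simps)
        then show ?thesis by (simp add: power_divide power2_eq_square mult_ac)
      qed
      finally show ?thesis by (simp add: r'_def)
    qed
    ultimately show ?thesis
      by (auto intro: has_vector_derivative_within_subset)
  qed
  have acr: "abs_continuous_on 0 L r"
    unfolding r_def divide_inverse A_def B_def
    by (intro abs_continuous_on_mult abs_continuous_on_inverse abs_continuous_on_lincomb ac \<open>0 \<le> L\<close>)
      (use A_nz in \<open>auto simp: A_def\<close>)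
  \<comment> \<open>The squared modulus is Lipschitz on the disc of radius \<open>R\<close>, where
    \<open>r\<close> stays.\<close>
  have acs: "abs_continuous_on 0 L s"
  proof (rule abs_continuous_on_dominated[OF acr acr, where M = R])
    fix x y assume xy: "x \<in> {0..L}" "y \<in> {0..L}"
    have "s x - s y = (r x + r y) \<bullet> (r x - r y)"
      unfolding s_def by (simp add: inner_diff_right inner_add_left inner_commute[of "r y" "r x"])
    also have "norm \<dots> \<le> cmod (r x + r y) * cmod (r x - r y)"
      using Cauchy_Schwarz_ineq2 by simp
    also have "\<dots> \<le> (R + R) * cmod (r x - r y)"
      using r_le xy by (intro mult_right_mono order.trans[OF norm_triangle_ineq] add_mono) auto
    finally show "norm (s x - s y) \<le> R * (cmod (r x - r y) + cmod (r x - r y))"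
      by (simp add: algebra_simps)
  qed
  define b where "b = Im k"
  have "b > 0" using k by (simp add: b_def)
  \<comment> \<open>Integrating factor for the damping rate \<open>4 * b\<close>, normalised by
    \<open>w L = 1\<close> so that the value at \<open>L\<close> appears without a weight, while
    \<open>w 0\<close> is the decay factor of the initial value.\<close>
  define w where "w = (\<lambda>x. exp (4 * b * (x - L)))"
  have dw: "(w has_vector_derivative 4 * b * w x) (at x within S)" for x S
    unfolding w_def has_real_derivative_iff_has_vector_derivative[symmetric]
    by (auto intro!: derivative_eq_intros)
  have acw: "abs_continuous_on 0 L w"
  proof (rule abs_continuous_on_lipschitz)
    have le: "\<bar>w x - w y\<bar> \<le> 4 * b * \<bar>x - y\<bar>" if "y \<le> x" "x \<le> L" for x y
    proof -
      \<comment> \<open>Uses \<open>w x \<le> 1\<close> and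
        \<open>1 - exp (- t) \<le> t\<close>.\<close>
      have "w x - w y = w x * (1 - exp (- (4 * b * (x - y))))"
        by (simp add: w_def right_diff_distrib flip: exp_add)
      also have "\<dots> \<le> 1 * (4 * b * (x - y))"
        using exp_ge_add_one_self[of "- (4 * b * (x - y))"] that \<open>b > 0\<close>
        by (intro mult_mono) (auto simp: w_def mult_nonneg_nonpos)
      finally have "w x - w y \<le> 4 * b * (x - y)" by simp
      moreover have "w y \<le> w x" using that \<open>b > 0\<close> by (simp add: w_def)
      ultimately show ?thesis using that by simp
    qed
    fix x y assume "x \<in> {0..L}" "y \<in> {0..L}"
    then show "norm (w x - w y) \<le> 4 * b * \<bar>x - y\<bar>"
      using le[of x y] le[of y x] by (cases "x \<le> y") (auto simp: abs_minus_commute)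
  qed
  define h' where "h' = (\<lambda>x. w x * (2 * (r x \<bullet> r' x)) + 4 * b * w x * s x)"
  have int_h: "(h' has_integral (w L * s L - w 0 * s 0)) {0..L}"
  proof (rule fundamental_theorem_of_calculus_abs_continuous[OF \<open>0 \<le> L\<close> _ E])
    show "abs_continuous_on 0 L (\<lambda>x. w x * s x)"
      by (rule abs_continuous_on_mult[OF acw acs])
    fix x assume x: "x \<in> {0..L} - E"
    have "(s has_vector_derivative 2 * (r x \<bullet> r' x)) (at x within {0..L})"
      using bounded_bilinear.has_vector_derivative[OF bounded_bilinear_inner dr[OF x] dr[OF x]]
      unfolding s_def by (simp add: inner_commute)
    from has_vector_derivative_mult[OF dw this]
    show "((\<lambda>x. w x * s x) has_vector_derivative h' x) (at x within {0..L})"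
      by (simp add: h'_def)
  qed
  define C where "C = R * (1 + R)\<^sup>2 / cmod k"
  have "C \<ge> 0" using \<open>R \<ge> 1\<close> by (simp add: C_def)
  have h'_le: "h' x \<le> C * ((V x)\<^sup>2 / (2 * \<eta>) + \<eta> / 2 * w x)" if "x \<in> {0..L}" for x
  proof -
    have x: "0 \<le> x" using that by simp
    \<comment> \<open>Only the real part of \<open>2 * \<i> * k\<close> changes the modulus of
      \<open>r\<close>. The resulting damping cancels the derivative of \<open>w\<close> exactly,
      leaving just the potential term.\<close>
    have "r x \<bullet> (2 * \<i> * k * r x) = - 2 * b * s x"
      by (simp add: inner_complex_def b_def s_def algebra_simps)
    then have "h' x = w x * (2 * (r x \<bullet> (- (V x * ((r x - 1)\<^sup>2 / (2 * \<i> * k))))))"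
      unfolding h'_def r'_def by (simp add: inner_diff_right algebra_simps)
    also have "\<dots> \<le> w x * (2 * (cmod (r x) * cmod (- (V x * ((r x - 1)\<^sup>2 / (2 * \<i> * k))))))"
      by (intro mult_left_mono norm_cauchy_schwarz) (auto simp: w_def)
    also have "\<dots> = w x * (cmod (r x) * (\<bar>V x\<bar> * ((cmod (r x - 1))\<^sup>2 / cmod k)))"
      by (simp add: norm_mult norm_divide norm_power)
    also have "\<dots> \<le> w x * (R * (\<bar>V x\<bar> * ((1 + R)\<^sup>2 / cmod k)))"
    proof -
      have "cmod (r x - 1) \<le> 1 + R"
        using norm_triangle_ineq4[of "r x" 1] r_le[OF x] by simp
      then show ?thesis
        using r_le[OF x] \<open>R \<ge> 1\<close>
        by (intro mult_left_mono mult_mono divide_right_mono power_mono) (auto simp: w_def)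
    qed
    also have "\<dots> = C * (w x * \<bar>V x\<bar>)" by (simp add: C_def)
    also have "\<dots> \<le> C * ((V x)\<^sup>2 / (2 * \<eta>) + \<eta> / 2 * w x)"
    proof (rule mult_left_mono[OF _ \<open>C \<ge> 0\<close>])
      have w: "0 \<le> w x" "w x \<le> 1" using that \<open>b > 0\<close> by (auto simp: w_def mult_nonneg_nonpos)
      have "0 \<le> (\<bar>V x\<bar> - \<eta>)\<^sup>2" by simp
      then have "\<bar>V x\<bar> \<le> (V x)\<^sup>2 / (2 * \<eta>) + \<eta> / 2"
        using \<open>\<eta> > 0\<close> by (simp add: field_simps power2_eq_square)
      then have "w x * \<bar>V x\<bar> \<le> w x * ((V x)\<^sup>2 / (2 * \<eta>)) + w x * (\<eta> / 2)"
        using w by (metis distrib_left mult_left_mono)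
      \<comment> \<open>The weight is dropped only from the \<open>V\<^sup>2\<close> term, whose
        integral is small by itself. It is kept on the constant term, whose unweighted integral
        would grow with \<open>L\<close>.\<close>
      also have "w x * ((V x)\<^sup>2 / (2 * \<eta>)) \<le> 1 * ((V x)\<^sup>2 / (2 * \<eta>))"
        using w \<open>\<eta> > 0\<close> by (intro mult_right_mono) auto
      finally show "w x * \<bar>V x\<bar> \<le> (V x)\<^sup>2 / (2 * \<eta>) + \<eta> / 2 * w x" by (simp add: mult.commute)
    qed
    finally show ?thesis .
  qed
  \<comment> \<open>This integral is at most \<open>1 / (4 * b)\<close>, whatever the length
    \<open>L\<close>.\<close>
  have int_w: "(w has_integral (w L / (4 * b) - w 0 / (4 * b))) {0..L}"
  proof (rule fundamental_theorem_of_calculus[OF \<open>0 \<le> L\<close>])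
    fix x
    show "((\<lambda>x. w x / (4 * b)) has_vector_derivative w x) (at x within {0..L})"
      using has_vector_derivative_divide[OF dw, where a = "4 * b"] \<open>b > 0\<close> by simp
  qed
  have "((\<lambda>x. C * ((V x)\<^sup>2 / (2 * \<eta>) + \<eta> / 2 * w x)) has_integral
      C * (J / (2 * \<eta>) + \<eta> / 2 * (w L / (4 * b) - w 0 / (4 * b)))) {0..L}"
    by (intro has_integral_mult_right has_integral_add has_integral_divide V int_w)
  from has_integral_le[OF int_h this h'_le]
  have "w L * s L - w 0 * s 0 \<le> C * (J / (2 * \<eta>) + \<eta> / 2 * (w L / (4 * b) - w 0 / (4 * b)))"
    by simp
  also have "\<dots> \<le> C * (J / (2 * \<eta>) + \<eta> / (8 * b))"
  proof -
    have "w L / (4 * b) - w 0 / (4 * b) \<le> 1 / (4 * b)"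
      using \<open>b > 0\<close> by (simp add: w_def)
    then have "\<eta> / 2 * (w L / (4 * b) - w 0 / (4 * b)) \<le> \<eta> / 2 * (1 / (4 * b))"
      using \<open>\<eta> > 0\<close> by (intro mult_left_mono) auto
    then show ?thesis using \<open>C \<ge> 0\<close> by (intro mult_left_mono) auto
  qed
  finally have "s L \<le> w 0 * s 0 + C * (J / (2 * \<eta>) + \<eta> / (8 * b))"
    by (simp add: w_def)
  also have "w 0 * s 0 \<le> w 0 * R\<^sup>2"
    using r_le[of 0] by (intro mult_left_mono) (auto simp: s_def w_def dot_square_norm intro: power_mono)
  finally show ?thesis
    using r_eq[OF \<open>0 \<le> L\<close>] unfolding s_def dot_square_norm m_def C_def b_def w_def
    by (simp add: algebra_simps)
qed

section \<open>Square roots, inversion of the Cayley transform and the squared potential\<close>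

text \<open>Identifies \<open>csqrt z\<close> as the root with both parts positive: their product is
  \<open>Im z / 2\<close>, and the principal branch has nonnegative real part.\<close>

lemma Re_Im_csqrt_pos:
  assumes "Im z > 0"
  shows "Re (csqrt z) > 0" "Im (csqrt z) > 0"
proof -
  have "Im z = 2 * Re (csqrt z) * Im (csqrt z)"
    using power2_csqrt[of z] by (metis Im_power2)
  then have "Re (csqrt z) * Im (csqrt z) > 0" using assms by linarith
  moreover have "Re (csqrt z) \<ge> 0" using csqrt_principal[of z] by auto
  ultimately show "Re (csqrt z) > 0" "Im (csqrt z) > 0"
    unfolding zero_less_mult_iff by linarith+
qed

lemma compact_continuous_pos_lower_bound:
  fixes g :: "'a::topological_space \<Rightarrow> real"
  assumes "compact K" "continuous_on K g" "\<And>x. x \<in> K \<Longrightarrow> g x > 0"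
  obtains c where "c > 0" "\<And>x. x \<in> K \<Longrightarrow> c \<le> g x"
proof (cases "K = {}")
  case True
  then show thesis using that[of 1] by auto
next
  case False
  then obtain x where "x \<in> K" "\<forall>y\<in>K. g x \<le> g y"
    using continuous_attains_inf[OF assms(1) _ assms(2)] by blast
  then show thesis using that[of "g x"] assms(3) by auto
qed

text \<open>Writing \<open>m + \<i> * k\<close> as \<open>(m - \<i> * k) + 2 * \<i> * k\<close>
  bounds the distance by \<open>\<rho>\<close> times itself plus \<open>2 * cmod k * \<rho>\<close>.
  As \<open>\<rho> \<le> 1 / 2\<close>, the first term is absorbed on the left.\<close>

lemma cayley_inverse_bound:
  assumes "m + \<i> * k \<noteq> 0" "cmod ((m - \<i> * k) / (m + \<i> * k)) \<le> \<rho>" "\<rho> \<le> 1 / 2"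
  shows "cmod (m - \<i> * k) \<le> 4 * cmod k * \<rho>"
proof -
  have "0 \<le> \<rho>" using assms(2) norm_ge_zero order.trans by blast
  have "m - \<i> * k = (m - \<i> * k) / (m + \<i> * k) * ((m - \<i> * k) + 2 * \<i> * k)"
  proof -
    have eq: "m - \<i> * k + 2 * \<i> * k = m + \<i> * k" by simp
    show ?thesis by (subst eq) (simp add: assms(1))
  qed
  then have "cmod (m - \<i> * k) = cmod ((m - \<i> * k) / (m + \<i> * k)) * cmod ((m - \<i> * k) + 2 * \<i> * k)"
    by (metis norm_mult)
  also have "\<dots> \<le> \<rho> * (cmod (m - \<i> * k) + 2 * cmod k)"
    using \<open>0 \<le> \<rho>\<close> assms(2) by (intro mult_mono order.trans[OF norm_triangle_ineq]) (auto simp: norm_mult)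
  also have "\<dots> \<le> 1 / 2 * cmod (m - \<i> * k) + 2 * cmod k * \<rho>"
    using mult_right_mono[OF assms(3), of "cmod (m - \<i> * k)"] by (simp add: algebra_simps)
  finally show ?thesis by simp
qed

text \<open>\<open>\<i> * k\<close> has height \<open>Re k\<close>, and
  \<open>t \<le> Re k / 2\<close> keeps \<open>m\<close> above half that height, so the denominator
  of \<open>gamma_dist\<close> is at least \<open>Re k / 2\<close>.\<close>

lemma gamma_dist_le:
  assumes k: "Re k > 0" and "cmod (m - \<i> * k) \<le> t" "t \<le> Re k / 2"
  shows "gamma_dist m (\<i> * k) \<le> 2 * t / Re k"
proof -
  have "\<bar>Im m - Re k\<bar> \<le> t"
    using abs_Im_le_cmod[of "m - \<i> * k"] assms(2) by simp
  then have "Re k / 2 \<le> Im m" using assms(3) by linarith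
  then have "sqrt (Re k / 2) * sqrt (Re k / 2) \<le> sqrt (Im m) * sqrt (Re k)"
    using k by (intro mult_mono) auto
  then have *: "Re k / 2 \<le> sqrt (Im m) * sqrt (Re k)" using k by simp
  have "0 \<le> t" using assms(2) norm_ge_zero order.trans by blast
  have "cmod (m - \<i> * k) / (sqrt (Im m) * sqrt (Re k)) \<le> t / (Re k / 2)"
    using assms(2) * k \<open>0 \<le> t\<close> by (intro frac_le) auto
  then show ?thesis by (simp add: gamma_dist_def mult.commute)
qed

text \<open>A potential need not be locally square integrable. Finiteness of the nonnegative
  integral supplies this on \<open>{0..L}\<close>, and the measurability comes from \<open>V\<close>
  being integrable there.\<close>

lemma potential_square_integral:
  assumes "potential V" "0 \<le> L"
    and lt: "(\<integral>\<^sup>+t\<in>{0..L}. ennreal (\<bar>V t\<bar>\<^sup>2) \<partial>lebesgue) < ennreal \<delta>"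
  obtains J where "((\<lambda>t. (V t)\<^sup>2) has_integral J) {0..L}" "J < \<delta>"
proof -
  define g where "g = (\<lambda>t. if t \<in> {0..L} then (V t)\<^sup>2 else 0)"
  define J where "J = enn2real (integral\<^sup>N lebesgue (\<lambda>t. ennreal (g t)))"
  have "V absolutely_integrable_on {0..L}"
    using assms unfolding potential_def by auto
  then have "V \<in> borel_measurable (lebesgue_on {0..L})"
    by (simp add: absolutely_integrable_measurable)
  then have "(\<lambda>t. (V t)\<^sup>2) \<in> borel_measurable (lebesgue_on {0..L})"
    by measurable
  then have g: "g \<in> borel_measurable lebesgue"
    unfolding g_def by (subst (asm) borel_measurable_if[symmetric]) auto
  have eq: "(\<integral>\<^sup>+t\<in>{0..L}. ennreal (\<bar>V t\<bar>\<^sup>2) \<partial>lebesgue) = integral\<^sup>N lebesgue (\<lambda>t. ennreal (g t))"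
    by (intro nn_integral_cong) (auto simp: g_def indicator_def)
  have fin: "integral\<^sup>N lebesgue (\<lambda>t. ennreal (g t)) = ennreal J"
    unfolding J_def using lt eq by (subst ennreal_enn2real) (auto intro: less_le_trans)
  have "J \<ge> 0" by (simp add: J_def)
  have "(g has_integral J) UNIV"
    by (subst has_integral_iff_nn_integral_lebesgue) (use g fin \<open>J \<ge> 0\<close> in \<open>auto simp: g_def\<close>)
  then have "((\<lambda>t. (V t)\<^sup>2) has_integral J) {0..L}"
    unfolding g_def by (simp only: has_integral_restrict_UNIV)
  moreover have "J < \<delta>"
    using lt unfolding eq fin by (simp add: ennreal_less_iff \<open>J \<ge> 0\<close>)
  ultimately show thesis by (rule that)
qed

section \<open>Constants uniform on the compact set and conclusion\<close>

text \<open>The smallness hypothesis uses the nonnegative integral, which is infinite unless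
  \<open>V\<^sup>2\<close> is integrable. The conclusion includes \<open>f L \<noteq> 0\<close> and
  membership in the half-plane, so that the bound on \<open>gamma_dist\<close> is not an artefact of
  division by zero.\<close>

theorem theorem1:
  fixes K :: "complex set" and \<epsilon> :: real
  assumes "compact K" and "K \<subseteq> upper_half_plane" and "\<epsilon> > 0"
  shows "\<exists>\<delta> N :: real. \<delta> > 0 \<and> N > 0 \<and>
    (\<forall>L V z f. L \<ge> N \<longrightarrow> potential V \<longrightarrow>
      (\<integral>\<^sup>+t\<in>{0..L}. ennreal (\<bar>V t\<bar>\<^sup>2) \<partial>lebesgue) < ennreal \<delta> \<longrightarrow>
      z \<in> K \<longrightarrow> schrodinger_solution V z f \<longrightarrow>
      f 0 \<noteq> 0 \<longrightarrow> Im (- (dx f 0 / f 0)) > 0 \<longrightarrow>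
      f L \<noteq> 0 \<and> - (dx f L / f L) \<in> upper_half_plane \<and>
      gamma_dist (- (dx f L / f L)) (\<i> * csqrt z) < \<epsilon>)"
proof -
  have K: "Im z > 0" if "z \<in> K" for z
    using that assms(2) by (auto simp: upper_half_plane_def)
  have "K \<subseteq> - \<real>\<^sub>\<le>\<^sub>0" using K by (force simp: complex_nonpos_Reals_iff)
  then have cont: "continuous_on K csqrt"
    using continuous_on_csqrt continuous_on_subset by blast
  obtain a where a: "a > 0" "\<And>z. z \<in> K \<Longrightarrow> a \<le> Re (csqrt z)"
    using compact_continuous_pos_lower_bound[OF assms(1) continuous_on_Re[OF cont] Re_Im_csqrt_pos(1)[OF K]]
    by blast
  obtain b where b: "b > 0" "\<And>z. z \<in> K \<Longrightarrow> b \<le> Im (csqrt z)"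
    using compact_continuous_pos_lower_bound[OF assms(1) continuous_on_Im[OF cont] Re_Im_csqrt_pos(2)[OF K]]
    by blast
  have "bounded (csqrt ` K)"
    by (intro compact_imp_bounded compact_continuous_image cont assms)
  then obtain M where M: "M > 0" "\<And>z. z \<in> K \<Longrightarrow> cmod (csqrt z) \<le> M"
    unfolding bounded_pos by auto
  \<comment> \<open>Target size of the Cayley transform at \<open>L\<close>. The three entries
    serve, in order, to invert the transform, to get \<open>4 * M * \<rho> \<le> Re k / 2\<close>,
    and to get the final bound \<open>\<epsilon> / 2\<close>.\<close>
  define \<rho> where "\<rho> = Min {1 / 2, a / (8 * M), \<epsilon> * a / (16 * M)}"
  have \<rho>: "\<rho> > 0" "\<rho> \<le> 1 / 2" "\<rho> \<le> a / (8 * M)" "\<rho> \<le> \<epsilon> * a / (16 * M)"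
    using a(1) M(1) \<open>\<epsilon> > 0\<close> by (auto simp: \<rho>_def)
  define R where "R = 1 + 2 * M / a"
  have "R \<ge> 1" using a(1) M(1) by (simp add: R_def)
  define C where "C = R * (1 + R)\<^sup>2 / a"
  have "C > 0" using \<open>R \<ge> 1\<close> a(1) by (simp add: C_def)
  \<comment> \<open>The estimate of \<open>\<bar>r\<bar>\<close> squared has three terms, each to be
    at most \<open>\<rho>\<^sup>2 / 3\<close>. First \<open>\<eta>\<close> settles the one free of
    \<open>V\<close>, then \<open>\<delta>\<close>, which depends on \<open>\<eta>\<close>, the one
    with the integral of \<open>V\<^sup>2\<close>; \<open>N\<close> settles the decaying initial
    value.\<close>
  define \<eta> where "\<eta> = 8 * b * \<rho>\<^sup>2 / (3 * C)"
  have "\<eta> > 0" using b(1) \<rho>(1) \<open>C > 0\<close> by (simp add: \<eta>_def)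
  define \<delta> where "\<delta> = 2 * \<eta> * \<rho>\<^sup>2 / (3 * C)"
  define N where "N = 3 * R\<^sup>2 / (4 * b * \<rho>\<^sup>2)"
  show ?thesis
  proof (rule exI[of _ \<delta>], rule exI[of _ N], intro conjI allI impI)
    show "\<delta> > 0" using \<open>\<eta> > 0\<close> \<rho>(1) \<open>C > 0\<close> by (simp add: \<delta>_def)
    show "N > 0" using \<open>R \<ge> 1\<close> b(1) \<rho>(1) by (simp add: N_def)
    fix L V z f
    assume L: "N \<le> L" and V: "potential V"
      "(\<integral>\<^sup>+t\<in>{0..L}. ennreal (\<bar>V t\<bar>\<^sup>2) \<partial>lebesgue) < ennreal \<delta>"
      and z: "z \<in> K" and sol: "schrodinger_solution V z f"
      and init: "f 0 \<noteq> 0" "Im (- (dx f 0 / f 0)) > 0"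
    have "L > 0" using L \<open>N > 0\<close> by simp
    then have "0 \<le> L" by simp
    show "f L \<noteq> 0"
      by (rule schrodinger_solution_half_plane(1)[OF sol K[OF z] \<open>0 \<le> L\<close> init])
    define m where "m = - (dx f L / f L)"
    have m: "Im m > 0"
      unfolding m_def by (rule schrodinger_solution_half_plane(2)[OF sol K[OF z] \<open>0 \<le> L\<close> init])
    then show "- (dx f L / f L) \<in> upper_half_plane"
      by (simp add: upper_half_plane_def m_def)
    define k where "k = csqrt z"
    have k: "a \<le> Re k" "b \<le> Im k" "cmod k \<le> M"
      using a(2)[OF z] b(2)[OF z] M(2)[OF z] by (auto simp: k_def)
    have kpos: "Re k > 0" "Im k > 0" using k a(1) b(1) by linarith+
    have sol': "schrodinger_solution V (k\<^sup>2) f" using sol by (simp add: k_def)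
    obtain J where J: "((\<lambda>t. (V t)\<^sup>2) has_integral J) {0..L}" "J < \<delta>"
      using potential_square_integral[OF V(1) \<open>0 \<le> L\<close> V(2)] by blast
    have "J \<ge> 0" using J(1) by (rule has_integral_nonneg) simp
    define r where "r = (m - \<i> * k) / (m + \<i> * k)"
    define Rk where "Rk = 1 + 2 * cmod k / Re k"
    have Rk: "0 \<le> Rk" "Rk \<le> R"
      using k kpos a(1) M(1) by (auto simp: Rk_def R_def intro!: frac_le)
    have "a \<le> cmod k" using k(1) abs_Re_le_cmod[of k] by linarith
    have "(cmod r)\<^sup>2 \<le> Rk\<^sup>2 * exp (- 4 * Im k * L) +
        Rk * (1 + Rk)\<^sup>2 / cmod k * (J / (2 * \<eta>) + \<eta> / (8 * Im k))"
      using schrodinger_solution_cayley_estimate[OF sol' kpos \<open>0 \<le> L\<close> init J(1) \<open>\<eta> > 0\<close>]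
      unfolding r_def m_def Rk_def .
    also have "\<dots> \<le> \<rho>\<^sup>2 / 3 + C * (\<delta> / (2 * \<eta>) + \<eta> / (8 * b))"
    proof (rule add_mono)
      have pos: "0 < 4 * b * N" "4 * b * N \<le> 4 * Im k * L"
        using b(1) \<open>N > 0\<close> L k(2) by (auto intro!: mult_mono)
      have "exp (- 4 * Im k * L) = 1 / exp (4 * Im k * L)" by (simp add: exp_minus field_simps)
      \<comment> \<open>The crude bound \<open>exp t \<ge> 1 + t\<close> is enough and keeps
        \<open>N\<close> free of logarithms.\<close>
      also have "\<dots> \<le> 1 / (4 * b * N)"
        using pos exp_ge_add_one_self[of "4 * Im k * L"]
        by (intro divide_left_mono) (linarith, simp, rule mult_pos_pos, auto)
      finally have "Rk\<^sup>2 * exp (- 4 * Im k * L) \<le> R\<^sup>2 * (1 / (4 * b * N))"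
        using Rk pos by (intro mult_mono power_mono) auto
      also have "\<dots> = \<rho>\<^sup>2 / 3"
        using \<open>R \<ge> 1\<close> b(1) \<rho>(1) by (simp add: N_def field_simps)
      finally show "Rk\<^sup>2 * exp (- 4 * Im k * L) \<le> \<rho>\<^sup>2 / 3" .
      show "Rk * (1 + Rk)\<^sup>2 / cmod k * (J / (2 * \<eta>) + \<eta> / (8 * Im k)) \<le> C * (\<delta> / (2 * \<eta>) + \<eta> / (8 * b))"
      \<comment> \<open>Both factors are replaced by bounds uniform on \<open>K\<close>, from
        \<open>Rk \<le> R\<close>, \<open>a \<le> cmod k\<close> and
        \<open>b \<le> Im k\<close>.\<close>
      proof (rule mult_mono)
        show "Rk * (1 + Rk)\<^sup>2 / cmod k \<le> C"
          unfolding C_def using Rk \<open>R \<ge> 1\<close> \<open>a \<le> cmod k\<close> a(1)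
          by (intro frac_le mult_mono power_mono) auto
        show "J / (2 * \<eta>) + \<eta> / (8 * Im k) \<le> \<delta> / (2 * \<eta>) + \<eta> / (8 * b)"
          using J(2) \<open>J \<ge> 0\<close> \<open>\<eta> > 0\<close> k(2) b(1) by (intro add_mono frac_le) auto
      qed (use \<open>C > 0\<close> \<open>J \<ge> 0\<close> \<open>\<eta> > 0\<close> kpos in auto)
    qed
    also have "\<dots> = \<rho>\<^sup>2"
    proof -
      have "C * (\<delta> / (2 * \<eta>)) = \<rho>\<^sup>2 / 3" using \<open>\<eta> > 0\<close> \<open>C > 0\<close> by (simp add: \<delta>_def)
      moreover have "C * (\<eta> / (8 * b)) = \<rho>\<^sup>2 / 3" using b(1) \<open>C > 0\<close> by (simp add: \<eta>_def)
      ultimately show ?thesis by (simp add: distrib_left)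
    qed
    finally have "cmod r \<le> \<rho>" using \<rho>(1) by (simp add: power2_le_iff_abs_le)
    then have "cmod (m - \<i> * k) \<le> 4 * cmod k * \<rho>"
      unfolding r_def by (rule cayley_inverse_bound[OF cayley_bound(1)[OF m kpos(1)] _ \<rho>(2)])
    also have "\<dots> \<le> 4 * M * \<rho>"
      using k(3) \<rho>(1) by (intro mult_right_mono) auto
    finally have "cmod (m - \<i> * k) \<le> 4 * M * \<rho>" .
    moreover have "4 * M * \<rho> \<le> Re k / 2"
      using \<rho>(3) M(1) k(1) by (simp add: field_simps)
    ultimately have "gamma_dist m (\<i> * k) \<le> 2 * (4 * M * \<rho>) / Re k"
      by (rule gamma_dist_le[OF kpos(1)])
    also have "\<dots> \<le> 2 * (4 * M * \<rho>) / a"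
      using a(1) k(1) M(1) \<rho>(1) by (intro frac_le) auto
    also have "\<dots> \<le> \<epsilon> / 2"
      using \<rho>(4) M(1) a(1) by (simp add: field_simps)
    also have "\<dots> < \<epsilon>" using \<open>\<epsilon> > 0\<close> by simp
    finally show "gamma_dist (- (dx f L / f L)) (\<i> * csqrt z) < \<epsilon>"
      by (simp add: m_def k_def)
  qed
qed

end
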